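(* Let $n$ and $\omega$ be positive integers with $n\left(1-\frac{1}{\lceil\sqrt{\omega}\rceil}-\frac{\lceil\sqrt{\omega}\rceil}{\omega}\right)\ge\lceil\sqrt{\omega}\rceil$. If $T$ is a reflexive tree of maximum degree at most $\frac{n}{\omega}$ and $\sigma$ is a voltage assignment on $T$ into $\mathbb{Z}_n$ that assigns to each loop a group element coprime to $n$, then $T^\sigma$ contains a cycle with at least $\left(1-\frac{1}{\lceil\sqrt{\omega}\rceil}-\frac{\lceil\sqrt{\omega}\rceil}{\omega}\right)|V(T^\sigma)|$ vertices.
   Context: A reflexive tree is a tree with exactly one loop at each vertex; its degree refers to the number of non-loop edges at a vertex. A voltage assignment is a map $\sigma$ from the arcs of $T$ (each edge $[u,v]$ gives arcs $(u,v),(v,u)$; each loop gives two arcs) to $\mathbb{Z}_n$ with $\sigma(v,u)=-\sigma(u,v)$ and the two loop arcs receiving opposite values. The lift $T^\sigma$ has vertex set $V(T)\times\mathbb{Z}_n$, with $(u,a)\sim(v,b)$ iff some arc $(u,v)$ has $\sigma(u,v)=b-a$. *)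

theory Defs
  imports Complex_Main "Graph_Theory.Graph_Theory"
begin

text \<open>
  Undirected (multi)graphs are bidirected digraphs: every edge or loop consists of two distinct arcs
  \<open>e\<close> and \<open>arev e\<close>, exchanged by the fixed-point-free involution \<open>arev\<close> of \<^locale>\<open>bidirected_digraph\<close>.
\<close>

text \<open>
  \<^const>\<open>pre_digraph.cycle\<close> also accepts loops and the closed walks \<open>u, v, u\<close> that traverse one edge back
  and forth. In a graph without parallel arcs, the bound on the length excludes exactly these. For the
  same reason the library's \<^const>\<open>tree\<close> is not usable for undirected trees.
\<close>

definition ucycle :: "('a, 'b) pre_digraph \<Rightarrow> 'b list \<Rightarrow> bool" where
  "ucycle G p \<longleftrightarrow> pre_digraph.cycle G p \<and> 3 \<le> length p"

definition cycle_verts :: "('a, 'b) pre_digraph \<Rightarrow> 'b list \<Rightarrow> 'a set" where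
  "cycle_verts G p = tail G ` set p"

definition utree :: "('a, 'b) pre_digraph \<Rightarrow> bool" where
  "utree G \<longleftrightarrow> graph G \<and> Digraph_Component.connected G \<and> \<not> (\<exists>p. ucycle G p)"

definition loop_arcs :: "('a, 'b) pre_digraph \<Rightarrow> 'b set" where
  "loop_arcs G = {e \<in> arcs G. tail G e = head G e}"

definition remove_loops :: "('a, 'b) pre_digraph \<Rightarrow> ('a, 'b) pre_digraph" where
  "remove_loops G = G\<lparr>arcs := arcs G - loop_arcs G\<rparr>"

text \<open>Exactly one loop at a vertex means exactly two loop arcs there, which are then swapped by \<open>arev\<close>.\<close>

definition reflexive_tree :: "('a, 'b) pre_digraph \<Rightarrow> ('b \<Rightarrow> 'b) \<Rightarrow> bool" where
  "reflexive_tree T arev \<longleftrightarrow>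
     bidirected_digraph T arev \<and>
     utree (remove_loops T) \<and>
     (\<forall>v \<in> verts T. card {e \<in> loop_arcs T. tail T e = v} = 2)"

definition nonloop_degree :: "('a, 'b) pre_digraph \<Rightarrow> 'a \<Rightarrow> nat" where
  "nonloop_degree T v = out_degree (remove_loops T) v"

text \<open>The group of integers modulo \<open>n\<close> is represented by the residues \<open>{0..<int n}\<close>.\<close>

definition voltage_assignment ::
  "nat \<Rightarrow> ('a, 'b) pre_digraph \<Rightarrow> ('b \<Rightarrow> 'b) \<Rightarrow> ('b \<Rightarrow> int) \<Rightarrow> bool" where
  "voltage_assignment n T arev \<sigma> \<longleftrightarrow>
     (\<forall>e \<in> arcs T. \<sigma> e \<in> {0..<int n} \<and> \<sigma> (arev e) = (- \<sigma> e) mod int n)"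

definition lift_graph ::
  "nat \<Rightarrow> ('a, 'b) pre_digraph \<Rightarrow> ('b \<Rightarrow> int) \<Rightarrow> ('a \<times> int) pair_pre_digraph" where
  "lift_graph n T \<sigma> =
     \<lparr> pverts = verts T \<times> {0..<int n},
       parcs = {((u, a), (v, b)) | u a v b.
                  a \<in> {0..<int n} \<and> b \<in> {0..<int n} \<and>
                  (\<exists>e \<in> arcs T. tail T e = u \<and> head T e = v \<and> \<sigma> e = (b - a) mod int n)} \<rparr>"

end

theory Submission
  imports Defs
begin

text \<open>
  Since loop voltages are coprime to \<open>n\<close>, every fibre of the lift is an \<open>n\<close>-cycle. Put
  \<open>k = \<lceil>\<surd>\<omega>\<rceil>\<close>. Starting from one fibre, absorb the other fibres one at a time, each along an edge
  \<open>uv\<close> of the tree with \<open>u\<close> already absorbed. Take \<open>k\<close> consecutive vertices of the current cycle that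
  lie in the fibre of \<open>u\<close>. Their neighbours in the fibre of \<open>v\<close> are \<open>k\<close> points on an \<open>n\<close>-cycle, so two
  of them are at distance at most \<open>n/k\<close>; join these two by the long arc of that cycle and reroute the
  current cycle through this arc. This skips fewer than \<open>k\<close> vertices over \<open>u\<close> and fewer than \<open>n/k\<close>
  over \<open>v\<close>. The arc has room for \<open>n/\<omega>\<close> disjoint blocks of \<open>k\<close> consecutive vertices, one for each
  neighbour of \<open>v\<close> still to be absorbed.
\<close>

section \<open>Closed vertex lists and library cycles\<close>

definition closed_path :: "('v \<Rightarrow> 'v \<Rightarrow> bool) \<Rightarrow> 'v list \<Rightarrow> bool" where
  "closed_path R c \<longleftrightarrow> 3 \<le> length c \<and> distinct c \<and> successively R (c @ [hd c])"

text \<open>Because \<open>c\<^sub>0\<close> and \<open>c\<^sub>1\<close> are nonempty, the closing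
  edge stays the same; together with the two vertices of \<open>P\<close> they also secure the
  length bound.\<close>

lemma closed_path_reroute:
  assumes "closed_path R (c\<^sub>0 @ M @ c\<^sub>1)" "c\<^sub>0 \<noteq> []" "c\<^sub>1 \<noteq> []" "2 \<le> length P"
    and "successively R P" "distinct P" "set P \<inter> set (c\<^sub>0 @ c\<^sub>1) = {}"
    and "R (last c\<^sub>0) (hd P)" "R (last P) (hd c\<^sub>1)"
  shows "closed_path R (c\<^sub>0 @ P @ c\<^sub>1)"
proof -
  have "P \<noteq> []" "1 \<le> length c\<^sub>0"
    using assms(2,4) by (auto simp: Suc_le_eq)
  then show ?thesis
    using assms unfolding closed_path_def
    by (auto simp: successively_append_iff)
qed

text \<open>An arc of a pair digraph is the pair of its ends, so zipping a vertex list with its tail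
  yields the arcs of the walk through it.\<close>

lemma awalk_zip_tl:
  assumes "xs \<noteq> []"
  shows "pre_digraph.cas (with_proj H) (hd xs) (zip xs (tl xs)) (last xs)"
    and "pre_digraph.awalk_verts (with_proj H) (hd xs) (zip xs (tl xs)) = xs"
proof -
  have "pre_digraph.cas (with_proj H) (hd xs) (zip xs (tl xs)) (last xs) \<and>
      pre_digraph.awalk_verts (with_proj H) (hd xs) (zip xs (tl xs)) = xs"
    using assms
    by (induction xs rule: induct_list012)
      (auto simp: pre_digraph.cas.simps pre_digraph.awalk_verts.simps)
  then show "pre_digraph.cas (with_proj H) (hd xs) (zip xs (tl xs)) (last xs)"
    and "pre_digraph.awalk_verts (with_proj H) (hd xs) (zip xs (tl xs)) = xs" by auto
qed

lemma set_zip_tl_successively: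
  "successively R xs \<Longrightarrow> (x, y) \<in> set (zip xs (tl xs)) \<Longrightarrow> R x y"
  by (induction xs rule: induct_list012) auto

text \<open>Splicing is done on vertex lists; this carries the result over to arc lists. The vertex
  set is kept exactly, so length bounds survive.\<close>

lemma closed_path_imp_ucycle:
  assumes "closed_path (\<lambda>x y. (x, y) \<in> parcs H) c" "set c \<subseteq> pverts H"
  shows "\<exists>p. ucycle (with_proj H) p \<and> cycle_verts (with_proj H) p = set c"
proof -
  define p where "p = zip (c @ [hd c]) (tl (c @ [hd c]))"
  have c: "c \<noteq> []" "3 \<le> length c" "distinct c"
    using assms(1) by (auto simp: closed_path_def)
  have "set p \<subseteq> parcs H"
  proof (rule subrelI)
    fix x y
    assume "(x, y) \<in> set p"
    moreover have "successively (\<lambda>x y. (x, y) \<in> parcs H) (c @ [hd c])"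
      using assms(1) unfolding closed_path_def by blast
    ultimately show "(x, y) \<in> parcs H"
      unfolding p_def by (rule set_zip_tl_successively[rotated])
  qed
  then have "pre_digraph.awalk (with_proj H) (hd c) p (hd c)"
    unfolding pre_digraph.awalk_def
    using awalk_zip_tl(1)[of "c @ [hd c]" H, folded p_def] c assms(2) hd_in_set[of c]
    by (simp add: subset_iff)
  moreover have "pre_digraph.awalk_verts (with_proj H) (hd c) p = c @ [hd c]"
    using awalk_zip_tl(2)[of "c @ [hd c]" H] c by (simp add: p_def)
  moreover have "distinct (tl (c @ [hd c]))"
    using c by (cases c) auto
  moreover have "length p = length c"
    using c by (simp add: p_def)
  ultimately have "ucycle (with_proj H) p"
    using c by (auto simp: ucycle_def pre_digraph.cycle_def)
  moreover have "map fst p = c"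
    using c by (simp add: p_def map_fst_zip_take)
  then have "cycle_verts (with_proj H) p = set c"
    unfolding cycle_verts_def by (simp flip: set_map)
  ultimately show ?thesis by blast
qed

section \<open>Cutting into blocks and a pigeonhole argument\<close>

text \<open>Cut off \<open>k\<close> entries \<open>D\<close> times and keep the remainder as one
  more piece, so that the concatenation is still all of \<open>P\<close>.\<close>

lemma exists_blocks:
  assumes "D * k \<le> length P"
  shows "\<exists>Bs. concat Bs = P \<and> D \<le> length (filter (\<lambda>b. length b = k) Bs)"
  using assms
proof (induction D arbitrary: P)
  case 0
  show ?case by (rule exI[of _ "[P]"]) simp
next
  case (Suc D)
  then have "D * k \<le> length (drop k P)" by simp
  then obtain Bs where "concat Bs = drop k P" "D \<le> length (filter (\<lambda>b. length b = k) Bs)"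
    using Suc.IH by blast
  then show ?case
    using Suc.prems by (intro exI[of _ "take k P # Bs"]) auto
qed

lemma two_points_close:
  fixes x :: "nat \<Rightarrow> int" and g :: int and n k :: nat
  assumes "2 \<le> k" "0 < n" and g: "coprime g (int n)"
  shows "\<exists>i j e. i < j \<and> j < k \<and> \<bar>e\<bar> \<le> int (n div k) \<and>
           x j mod int n = (x i + e * g) mod int n"
proof -
  \<comment> \<open>The \<open>k\<close> arcs \<open>x i, x i + g, \<dots>\<close> of \<open>q\<close> points each cannot be pairwise disjoint.\<close>
  define q where "q = Suc (n div k)"
  define f where "f = (\<lambda>(i, a). (x i + int a * g) mod int n)"
  have "n < k * q"
    using assms(1) unfolding q_def by (metis mult_Suc_right dividend_less_times_div pos2 less_le_trans add.commute)
  moreover have "f ` ({..<k} \<times> {..<q}) \<subseteq> {0..<int n}"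
    using assms by (auto simp: f_def)
  then have "card (f ` ({..<k} \<times> {..<q})) \<le> n"
    using card_mono[of "{0..<int n}"] by simp
  ultimately have "\<not> inj_on f ({..<k} \<times> {..<q})"
    by (intro pigeonhole) (simp add: card_cartesian_product)
  then obtain i a j b where ij: "i < k" "j < k" and ab: "a < q" "b < q" and ne: "(i, a) \<noteq> (j, b)"
    and eq: "(x i + int a * g) mod int n = (x j + int b * g) mod int n"
    unfolding inj_on_def f_def by auto
  have key: "x j' mod int n = (x i' + (int a' - int b') * g) mod int n"
    if "(x i' + int a' * g) mod int n = (x j' + int b' * g) mod int n" for i' j' a' b'
  proof -
    have "int n dvd (x j' + int b' * g) - (x i' + int a' * g)"
      using that by (metis mod_eq_dvd_iff)
    then show ?thesis
      by (simp add: mod_eq_dvd_iff algebra_simps)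
  qed
  \<comment> \<open>Inside one arc no point repeats: \<open>g\<close> is invertible modulo
    \<open>n\<close> and \<open>q \<le> n\<close>. So the collision is between two different
    arcs.\<close>
  have "i \<noteq> j"
  proof
    assume "i = j"
    then have "int n dvd (x i + int a * g) - (x i + int b * g)"
      using eq by (simp add: mod_eq_dvd_iff)
    then have "int n dvd (int a - int b) * g" by (simp add: algebra_simps)
    then have "int n dvd int a - int b"
      using g by (simp add: coprime_commute coprime_dvd_mult_left_iff)
    moreover have "n div k < n" using assms by simp
    then have "\<bar>int a - int b\<bar> < int n" using ab unfolding q_def by linarith
    ultimately have "a = b" using zdvd_not_zless[of "\<bar>int a - int b\<bar>" "int n"] by auto
    then show False using ne \<open>i = j\<close> by simp
  qed
  \<comment> \<open>Exchanging the two indices only negates the offset, which is why only its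
    absolute value is bounded.\<close>
  then consider "i < j" | "j < i" by linarith
  then show ?thesis
  proof cases
    case 1
    have "\<bar>int a - int b\<bar> \<le> int (n div k)" using ab by (simp add: q_def)
    then show ?thesis using key[OF eq] 1 ij by blast
  next
    case 2
    have "\<bar>int b - int a\<bar> \<le> int (n div k)" using ab by (simp add: q_def)
    then show ?thesis using key[OF eq[symmetric]] 2 ij by blast
  qed
qed

section \<open>Leaving a vertex set; neighbours\<close>

text \<open>A walk from \<open>S\<close> to its complement has to cross over at some arc.\<close>

lemma ex_arc_leaving:
  assumes "wf_digraph G" "strongly_connected G" "S \<subset> verts G" "S \<noteq> {}"
  shows "\<exists>e \<in> arcs G. tail G e \<in> S \<and> head G e \<in> verts G - S"
proof -
  interpret wf_digraph G by fact
  obtain u v where "u \<in> S" "v \<in> verts G - S" using assms by blast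
  then have "u \<rightarrow>\<^sup>*\<^bsub>G\<^esub> v" using assms by (auto simp: strongly_connected_def)
  then show ?thesis using \<open>u \<in> S\<close> \<open>v \<in> verts G - S\<close>
  proof (induction rule: converse_reachable_induct)
    case base
    then show ?case by simp
  next
    case (step x y)
    from step(1) obtain e where e: "e \<in> arcs G" "tail G e = x" "head G e = y" by auto
    show ?case
    proof (cases "y \<in> S")
      case True
      then show ?thesis using step by blast
    next
      case False
      then show ?thesis using e step.prems by auto
    qed
  qed
qed

definition neighbours :: "('a, 'b) pre_digraph \<Rightarrow> 'a \<Rightarrow> 'a set" where
  "neighbours G u = head G ` out_arcs G u"

lemma (in fin_digraph) finite_neighbours: "finite (neighbours G u)"
  by (simp add: neighbours_def finite_out_arcs)

lemma (in fin_digraph) card_neighbours_le: "card (neighbours G u) \<le> out_degree G u"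
  by (simp add: neighbours_def out_degree_def card_image_le finite_out_arcs)

section \<open>Adjacency in the lift\<close>

text \<open>The two loop assumptions make every fibre a closed walk through all its points, and
  \<open>n_ge_3\<close> makes it long enough to count as a cycle.\<close>

locale coprime_lift =
  fixes n :: nat and T :: "('a, 'b) pre_digraph" and arev :: "'b \<Rightarrow> 'b" and \<sigma> :: "'b \<Rightarrow> int"
  assumes bidir: "bidirected_digraph T arev"
    and volt: "voltage_assignment n T arev \<sigma>"
    and ex_loop: "v \<in> verts T \<Longrightarrow> \<exists>e \<in> loop_arcs T. tail T e = v"
    and loops_coprime: "e \<in> loop_arcs T \<Longrightarrow> coprime (\<sigma> e) (int n)"
    and n_ge_3: "3 \<le> n"
begin

definition ladj :: "'a \<times> int \<Rightarrow> 'a \<times> int \<Rightarrow> bool" where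
  "ladj x y \<longleftrightarrow> (x, y) \<in> parcs (lift_graph n T \<sigma>)"

lemma ladj_arc:
  assumes "e \<in> arcs T" "a \<in> {0..<int n}"
  shows "ladj (tail T e, a) (head T e, (a + \<sigma> e) mod int n)"
proof -
  have "\<sigma> e \<in> {0..<int n}"
    using assms volt by (auto simp: voltage_assignment_def)
  then have "\<sigma> e = ((a + \<sigma> e) mod int n - a) mod int n"
    by (simp add: mod_diff_left_eq)
  then show ?thesis
    using assms n_ge_3 by (auto simp: ladj_def lift_graph_def)
qed

lemma ladj_sym:
  assumes "ladj x y"
  shows "ladj y x"
proof -
  interpret bidirected_digraph T arev by (rule bidir)
  obtain u a v b e where xy: "x = (u, a)" "y = (v, b)" and ab: "a \<in> {0..<int n}" "b \<in> {0..<int n}"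
    and e: "e \<in> arcs T" "tail T e = u" "head T e = v" "\<sigma> e = (b - a) mod int n"
    using assms by (auto simp: ladj_def lift_graph_def)
  have "\<sigma> (arev e) = (a - b) mod int n"
    using volt e by (simp add: voltage_assignment_def mod_minus_eq)
  moreover have "arev e \<in> arcs T" "tail T (arev e) = v" "head T (arev e) = u"
    using e by auto
  ultimately show ?thesis
    using ab xy by (auto simp: ladj_def lift_graph_def)
qed

section \<open>Fibres as cycles\<close>

text \<open>The step \<open>d\<close> may be negative, so one definition covers both directions
  round the fibre; \<open>a\<close> need not be reduced modulo \<open>n\<close>.\<close>

definition fibre_path :: "'a \<Rightarrow> int \<Rightarrow> int \<Rightarrow> nat \<Rightarrow> ('a \<times> int) list" where
  "fibre_path v d a m = map (\<lambda>t. (v, (a + int t * d) mod int n)) [0..<m]"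

lemma length_fibre_path [simp]: "length (fibre_path v d a m) = m"
  by (simp add: fibre_path_def)

lemma set_fibre_path: "set (fibre_path v d a m) \<subseteq> {v} \<times> {0..<int n}"
  using n_ge_3 by (auto simp: fibre_path_def)

lemma hd_fibre_path: "0 < m \<Longrightarrow> hd (fibre_path v d a m) = (v, a mod int n)"
  by (simp add: fibre_path_def hd_map)

lemma last_fibre_path: "last (fibre_path v d a (Suc m)) = (v, (a + int m * d) mod int n)"
  by (simp add: fibre_path_def)

text \<open>A coprime step can be cancelled modulo \<open>n\<close>, and fewer than \<open>n\<close>
  steps separate any two positions.\<close>

lemma distinct_fibre_path:
  assumes "coprime d (int n)" "m \<le> n"
  shows "distinct (fibre_path v d a m)"
proof -
  have "s = t" if "s < m" "t < m" "(a + int s * d) mod int n = (a + int t * d) mod int n" for s t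
  proof -
    have "int n dvd (int s - int t) * d"
      using that(3) by (simp add: mod_eq_dvd_iff algebra_simps)
    then have "int n dvd int s - int t"
      using assms(1) by (simp add: coprime_commute coprime_dvd_mult_left_iff)
    moreover have "\<bar>int s - int t\<bar> < int n" using that assms(2) by linarith
    ultimately show ?thesis
      using zdvd_not_zless[of "\<bar>int s - int t\<bar>" "int n"] by auto
  qed
  then show ?thesis
    by (auto simp: fibre_path_def distinct_map inj_on_def)
qed

lemma successively_fibre_path:
  assumes "\<And>x. x \<in> {0..<int n} \<Longrightarrow> ladj (v, x) (v, (x + d) mod int n)"
  shows "successively ladj (fibre_path v d a m)"
proof (induction m)
  case 0
  show ?case by (simp add: fibre_path_def)
next
  case (Suc m)
  have app: "fibre_path v d a (Suc m) = fibre_path v d a m @ [(v, (a + int m * d) mod int n)]"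
    by (simp add: fibre_path_def)
  show ?case
  proof (cases m)
    case 0
    then show ?thesis by (simp add: fibre_path_def)
  next
    case (Suc l)
    have "ladj (last (fibre_path v d a m)) (v, (a + int m * d) mod int n)"
      using assms[of "(a + int l * d) mod int n"] n_ge_3 Suc last_fibre_path[of v d a l]
      by (simp add: mod_add_left_eq distrib_right ac_simps(1) add.commute[of d])
    then show ?thesis
      using Suc.IH by (simp add: app successively_append_iff)
  qed
qed

text \<open>The generator is the voltage of a loop arc; symmetry of adjacency gives the opposite
  step. Both are provided because a detour chooses its direction.\<close>

lemma ex_fibre_generator:
  assumes "v \<in> verts T"
  obtains g where "coprime g (int n)"
    and "\<And>x. x \<in> {0..<int n} \<Longrightarrow> ladj (v, x) (v, (x + g) mod int n)"
    and "\<And>x. x \<in> {0..<int n} \<Longrightarrow> ladj (v, x) (v, (x + - g) mod int n)"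
proof -
  obtain e where e: "e \<in> loop_arcs T" "tail T e = v" using ex_loop[OF assms] by blast
  have fwd: "ladj (v, x) (v, (x + \<sigma> e) mod int n)" if "x \<in> {0..<int n}" for x
    using ladj_arc[of e x] e that by (auto simp: loop_arcs_def)
  have bwd: "ladj (v, x) (v, (x + - \<sigma> e) mod int n)" if "x \<in> {0..<int n}" for x
  proof -
    have "ladj (v, (x - \<sigma> e) mod int n) (v, x)"
      using fwd[of "(x - \<sigma> e) mod int n"] that n_ge_3 by (simp add: mod_add_left_eq)
    then show ?thesis using ladj_sym by simp
  qed
  show ?thesis using that[OF loops_coprime[OF e(1)] fwd bwd] .
qed

lemma closed_path_fibre:
  assumes "v \<in> verts T"
  shows "\<exists>c. closed_path ladj c \<and> set c \<subseteq> {v} \<times> {0..<int n} \<and> length c = n"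
proof -
  obtain g where g: "coprime g (int n)"
    "\<And>x. x \<in> {0..<int n} \<Longrightarrow> ladj (v, x) (v, (x + g) mod int n)"
    using ex_fibre_generator[OF assms] by blast
  \<comment> \<open>After \<open>n\<close> steps the path is back at its start, so
    \<open>n + 1\<close> vertices form the closed-up list that \<open>closed_path\<close> asks
    for.\<close>
  have "fibre_path v g 0 (Suc n) = fibre_path v g 0 n @ [hd (fibre_path v g 0 n)]"
    using n_ge_3 by (simp add: hd_fibre_path) (simp add: fibre_path_def)
  then have "closed_path ladj (fibre_path v g 0 n)"
    using successively_fibre_path[of v g 0 "Suc n"] g distinct_fibre_path[of g n v 0] n_ge_3
    by (simp add: closed_path_def)
  then show ?thesis
    using set_fibre_path[of v g 0 n] length_fibre_path by blast
qed

section \<open>The detour through a new fibre\<close>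

text \<open>The arc \<open>e\<close> translates the fibre over \<open>u\<close> by
  \<open>\<sigma> e\<close>, so offsets between entries of \<open>b\<close> persist between their
  images over \<open>v\<close>. Two entries have a small offset by \<open>two_points_close\<close>;
  \<open>P\<close> joins their images the long way round, and \<open>M\<close> is what lies between
  them in \<open>b\<close>.\<close>

lemma ex_detour:
  assumes e: "e \<in> arcs T" "tail T e = u" "head T e = v"
    and b: "length b = k" "distinct b" "set b \<subseteq> {u} \<times> {0..<int n}" and "2 \<le> k"
  shows "\<exists>b\<^sub>1 M b\<^sub>2 P. b = b\<^sub>1 @ M @ b\<^sub>2 \<and> b\<^sub>1 \<noteq> [] \<and> b\<^sub>2 \<noteq> [] \<and>
    successively ladj P \<and> distinct P \<and> set P \<subseteq> {v} \<times> {0..<int n} \<and>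
    ladj (last b\<^sub>1) (hd P) \<and> ladj (last P) (hd b\<^sub>2) \<and> n - n div k + 1 \<le> length P"
proof -
  interpret bidirected_digraph T arev by (rule bidir)
  have "v \<in> verts T" using e by auto
  then obtain g where g: "coprime g (int n)"
    "\<And>x. x \<in> {0..<int n} \<Longrightarrow> ladj (v, x) (v, (x + g) mod int n)"
    "\<And>x. x \<in> {0..<int n} \<Longrightarrow> ladj (v, x) (v, (x + - g) mod int n)"
    using ex_fibre_generator by blast
  define x where "x i = snd (b ! i)" for i
  have bx: "b ! i = (u, x i)" "x i \<in> {0..<int n}" if "i < k" for i
  proof -
    have "b ! i \<in> {u} \<times> {0..<int n}" using b that nth_mem by blast
    then show "b ! i = (u, x i)" "x i \<in> {0..<int n}" by (auto simp: x_def)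
  qed
  obtain i j t where ij: "i < j" "j < k" and t: "\<bar>t\<bar> \<le> int (n div k)"
    and eq: "x j mod int n = (x i + t * g) mod int n"
    using two_points_close[of k n g x] g(1) n_ge_3 \<open>2 \<le> k\<close> by auto
  \<comment> \<open>A nonzero offset ensures that the long arc has at most \<open>n\<close> vertices
    and so does not run into its own start.\<close>
  have "b ! i \<noteq> b ! j" using b ij by (simp add: nth_eq_iff_index_eq)
  then have "x i \<noteq> x j" using bx ij by auto
  then have "t \<noteq> 0" using eq bx[of i] bx[of j] ij by auto
  have "n div k < n" using n_ge_3 \<open>2 \<le> k\<close> by simp
  \<comment> \<open>The short way takes \<open>t\<close> steps of \<open>g\<close>; the long way
    goes in the opposite direction and takes \<open>n - \<bar>t\<bar>\<close> steps, hence one more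
    vertex than that.\<close>
  define d where "d = (if 0 < t then - g else g)"
  define r where "r = n - nat \<bar>t\<bar>"
  define P where "P = fibre_path v d (x i + \<sigma> e) (Suc r)"
  have r: "int r = int n - \<bar>t\<bar>" using t \<open>n div k < n\<close> by (simp add: r_def)
  have "Suc r \<le> n" using \<open>t \<noteq> 0\<close> r by linarith
  have d: "coprime d (int n)" "\<And>x. x \<in> {0..<int n} \<Longrightarrow> ladj (v, x) (v, (x + d) mod int n)"
    using g by (auto simp: d_def)
  have "distinct P" "successively ladj P"
    using distinct_fibre_path[OF d(1) \<open>Suc r \<le> n\<close>] successively_fibre_path[OF d(2)]
    by (auto simp: P_def)
  moreover have "set P \<subseteq> {v} \<times> {0..<int n}" unfolding P_def by (rule set_fibre_path)
  moreover have step: "ladj (b ! l) (v, (x l + \<sigma> e) mod int n)" if "l < k" for l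
    using ladj_arc[OF e(1) bx(2)[OF that]] e bx(1)[OF that] by simp
  have "ladj (b ! i) (hd P)"
    using step[of i] ij by (simp add: P_def hd_fibre_path)
  moreover have "last P = (v, (x j + \<sigma> e) mod int n)"
  proof -
    \<comment> \<open>Since \<open>n\<close> steps are trivial modulo \<open>n\<close>, the long way
      ends where the short way does.\<close>
    have "int r * d = t * g + int n * d"
      using \<open>t \<noteq> 0\<close> by (simp add: r d_def algebra_simps)
    then have "(x i + \<sigma> e + int r * d) mod int n = (x i + t * g + \<sigma> e + int n * d) mod int n"
      by (simp add: algebra_simps)
    also have "\<dots> = ((x i + t * g) mod int n + \<sigma> e) mod int n"
      by (simp add: mod_add_left_eq)
    also have "\<dots> = (x j + \<sigma> e) mod int n"
      by (simp add: mod_add_left_eq flip: eq)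
    finally show ?thesis by (simp add: P_def last_fibre_path)
  qed
  then have "ladj (last P) (b ! j)"
    using step[of j] ij ladj_sym by simp
  moreover have "n - n div k + 1 \<le> length P"
    using r t unfolding P_def length_fibre_path by linarith
  moreover have "b = take (Suc i) b @ drop (Suc i) (take j b) @ drop j b"
    using ij by (metis Suc_leI append.assoc append_take_drop_id min.absorb1 take_take)
  moreover have "take (Suc i) b \<noteq> []" "last (take (Suc i) b) = b ! i" "drop j b \<noteq> []"
    "hd (drop j b) = b ! j"
    using ij b(1) by (auto simp: take_Suc_conv_app_nth hd_drop_conv_nth)
  ultimately show ?thesis by metis
qed

section \<open>Partial cycles and absorbing one fibre\<close>

definition block :: "nat \<Rightarrow> 'a \<Rightarrow> ('a \<times> int) list \<Rightarrow> bool" where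
  "block k u b \<longleftrightarrow> length b = k \<and> set b \<subseteq> {u} \<times> {0..<int n}"

text \<open>
  The current cycle is stored cut into pieces, so that the pieces which are blocks over \<open>u\<close> are
  disjoint stretches of it; at least as many remain as there are neighbours of \<open>u\<close> to absorb.
\<close>

definition partial_cycle :: "nat \<Rightarrow> 'a set \<Rightarrow> ('a \<times> int) list list \<Rightarrow> bool" where
  "partial_cycle k S L \<longleftrightarrow>
     closed_path ladj (concat L) \<and> set (concat L) \<subseteq> S \<times> {0..<int n} \<and>
     (\<forall>u \<in> S. card (neighbours (remove_loops T) u - S) \<le> length (filter (block k u) L)) \<and>
     card S * (n - n div k) + k \<le> length (concat L) + card S * k"

lemma exists_blocks_fibre:
  assumes "D * k \<le> length P" "set P \<subseteq> {v} \<times> {0..<int n}"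
  shows "\<exists>Bs. concat Bs = P \<and> D \<le> length (filter (block k v) Bs)"
proof -
  obtain Bs where Bs: "concat Bs = P" "D \<le> length (filter (\<lambda>b. length b = k) Bs)"
    using exists_blocks[OF assms(1)] by blast
  have "filter (\<lambda>b. length b = k) Bs = filter (block k v) Bs"
    using assms(2) unfolding Bs(1)[symmetric] set_concat block_def
    by (intro filter_cong refl) blast
  then show ?thesis using Bs by metis
qed

text \<open>The whole fibre serves as the first cycle. The summand \<open>k\<close> in the length
  estimate records that only \<open>card S - 1\<close> absorptions have cost up to \<open>k\<close>
  vertices; the additive form avoids truncated subtraction.\<close>

lemma partial_cycle_singleton:
  assumes "v \<in> verts T" "card (neighbours (remove_loops T) v) * k \<le> n"
    and "finite (neighbours (remove_loops T) v)"
  shows "\<exists>L. partial_cycle k {v} L"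
proof -
  obtain c where c: "closed_path ladj c" "set c \<subseteq> {v} \<times> {0..<int n}" "length c = n"
    using closed_path_fibre[OF assms(1)] by blast
  obtain L where L: "concat L = c"
    "card (neighbours (remove_loops T) v) \<le> length (filter (block k v) L)"
    using exists_blocks_fibre[of "card (neighbours (remove_loops T) v)" k c v] c assms(2) by auto
  have "card (neighbours (remove_loops T) v - {v}) \<le> card (neighbours (remove_loops T) v)"
    using assms(3) by (intro card_mono) auto
  then have "partial_cycle k {v} L"
    using c L by (auto simp: partial_cycle_def simp del: set_concat)
  then show ?thesis by blast
qed

text \<open>One block over \<open>u\<close> is spent on the detour, but \<open>v\<close> also stops
  being an outstanding neighbour of \<open>u\<close>. The detour is long enough to be cut into the
  blocks that \<open>v\<close> requires.\<close>

lemma partial_cycle_insert: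
  assumes L: "partial_cycle k S L" and "finite S" "2 \<le> k"
    and fin: "\<And>w. w \<in> insert v S \<Longrightarrow> finite (neighbours (remove_loops T) w)"
    and uv: "u \<in> S" "v \<in> neighbours (remove_loops T) u" "v \<notin> S"
    and deg: "card (neighbours (remove_loops T) v) * k \<le> n - n div k + 1"
  shows "\<exists>L'. partial_cycle k (insert v S) L'"
proof -
  let ?N = "neighbours (remove_loops T)"
  have L1: "closed_path ladj (concat L)" and L2: "set (concat L) \<subseteq> S \<times> {0..<int n}"
    and L3: "\<And>w. w \<in> S \<Longrightarrow> card (?N w - S) \<le> length (filter (block k w) L)"
    and L4: "card S * (n - n div k) + k \<le> length (concat L) + card S * k"
    using L unfolding partial_cycle_def by blast+
  obtain e where e: "e \<in> arcs T" "tail T e = u" "head T e = v"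
    using uv(2) by (auto simp: neighbours_def remove_loops_def)
  have less: "card (?N w - insert v S) < card (?N w - S)" if "w \<in> S" "v \<in> ?N w" for w
    using that uv(3) fin[of w] by (intro psubset_card_mono) auto
  \<comment> \<open>Since \<open>v\<close> is itself an outstanding neighbour of \<open>u\<close>,
    the invariant guarantees a block.\<close>
  have "filter (block k u) L \<noteq> []"
    using L3[OF uv(1)] less[OF uv(1,2)] by (cases "filter (block k u) L") auto
  then obtain b where "b \<in> set L" "block k u b" by (auto simp: filter_empty_conv)
  then obtain L\<^sub>1 L\<^sub>2 where Leq: "L = L\<^sub>1 @ b # L\<^sub>2" by (auto simp: in_set_conv_decomp)
  have "distinct b" using L1 by (simp add: closed_path_def Leq)
  then obtain b\<^sub>1 M b\<^sub>2 P where b: "b = b\<^sub>1 @ M @ b\<^sub>2" "b\<^sub>1 \<noteq> []" "b\<^sub>2 \<noteq> []"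
    and P: "successively ladj P" "distinct P" "set P \<subseteq> {v} \<times> {0..<int n}"
      "ladj (last b\<^sub>1) (hd P)" "ladj (last P) (hd b\<^sub>2)" "n - n div k + 1 \<le> length P"
    using ex_detour[OF e, of b k] \<open>block k u b\<close> \<open>2 \<le> k\<close> by (auto simp: block_def)
  obtain Bs where Bs: "concat Bs = P" "card (?N v) \<le> length (filter (block k v) Bs)"
    using exists_blocks_fibre[of "card (?N v)" k P v] deg P by auto
  define L' where "L' = L\<^sub>1 @ b\<^sub>1 # Bs @ b\<^sub>2 # L\<^sub>2"
  have cL: "concat L = (concat L\<^sub>1 @ b\<^sub>1) @ M @ (b\<^sub>2 @ concat L\<^sub>2)"
    by (simp add: Leq b)
  have cL': "concat L' = (concat L\<^sub>1 @ b\<^sub>1) @ P @ (b\<^sub>2 @ concat L\<^sub>2)"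
    by (simp add: L'_def Bs)
  have "n div k < n" using n_ge_3 \<open>2 \<le> k\<close> by simp
  then have "2 \<le> length P" using P by linarith
  have "set P \<inter> set (concat L) = {}" using P L2 uv(3) by fast
  then have "closed_path ladj (concat L')"
    unfolding cL' using b(2,3) P \<open>2 \<le> length P\<close>
    by (intro closed_path_reroute[OF L1[unfolded cL]]) (auto simp: cL)
  moreover have "set (concat L') \<subseteq> insert v S \<times> {0..<int n}"
    using L2 P(3) unfolding cL cL' set_append by blast
  moreover have "card (?N w - insert v S) \<le> length (filter (block k w) L')" if w: "w \<in> insert v S" for w
  proof (cases "w = v")
    case True
    have "card (?N v - insert v S) \<le> card (?N v)" using fin by (intro card_mono) auto
    then show ?thesis using Bs True by (simp add: L'_def)
  next
    case False
    then have "w \<in> S" using w by simp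
    show ?thesis
    proof (cases "w = u")
      case True
      \<comment> \<open>The strict inequality pays for the block \<open>b\<close> that has been cut
        up.\<close>
      then have "card (?N w - insert v S) < length (filter (block k w) L)"
        using less[OF uv(1,2)] L3[OF uv(1)] by simp
      then show ?thesis using \<open>block k u b\<close> True by (simp add: L'_def Leq)
    next
      case False
      \<comment> \<open>A nonempty block lies over only one vertex, so breaking up \<open>b\<close>
        costs \<open>w\<close> nothing.\<close>
      have "\<not> block k w b" using \<open>block k u b\<close> b(1,2) False by (cases b\<^sub>1) (auto simp: block_def)
      then have "length (filter (block k w) L) \<le> length (filter (block k w) L')"
        by (simp add: L'_def Leq)
      moreover have "card (?N w - insert v S) \<le> card (?N w - S)"
        using fin[of w] \<open>w \<in> S\<close> by (intro card_mono) auto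
      ultimately show ?thesis using L3[OF \<open>w \<in> S\<close>] by linarith
    qed
  qed
  moreover have "card (insert v S) * (n - n div k) + k \<le> length (concat L') + card (insert v S) * k"
  proof -
    \<comment> \<open>At most \<open>k\<close> vertices are dropped and at least
      \<open>n - n div k\<close> are gained, as the invariant demands.\<close>
    have "length M \<le> k" using \<open>block k u b\<close> by (simp add: block_def b)
    moreover have "length (concat L') + length M = length (concat L) + length P"
      unfolding cL cL' by simp
    ultimately show ?thesis
      using L4 P(6) uv(3) \<open>finite S\<close> by (simp add: algebra_simps)
  qed
  ultimately show ?thesis unfolding partial_cycle_def by blast
qed

section \<open>Absorbing all fibres\<close>

text \<open>Induction on the number of absorbed fibres: connectivity supplies an arc leaving
  \<open>S\<close>, and its head is absorbed next.\<close>

lemma ex_partial_cycle: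
  assumes base: "fin_digraph (remove_loops T)" "strongly_connected (remove_loops T)" and "2 \<le> k"
    and deg: "\<And>v. v \<in> verts T \<Longrightarrow> nonloop_degree T v * k \<le> n - n div k"
  shows "\<exists>L. partial_cycle k (verts T) L"
proof -
  interpret B: fin_digraph "remove_loops T" by (rule base)
  have vB: "verts (remove_loops T) = verts T" by (simp add: remove_loops_def)
  have deg': "card (neighbours (remove_loops T) v) * k \<le> n - n div k" if "v \<in> verts T" for v
    using deg[OF that] B.card_neighbours_le[of v] unfolding nonloop_degree_def
    by (meson le_trans mult_le_mono1)
  have "\<exists>S L. S \<subseteq> verts T \<and> card S = Suc m \<and> partial_cycle k S L" if "Suc m \<le> card (verts T)" for m
    using that
  proof (induction m)
    case 0
    obtain v where v: "v \<in> verts T" using base(2) vB by (auto simp: strongly_connected_def)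
    obtain L where "partial_cycle k {v} L"
      using partial_cycle_singleton[OF v, of k] deg'[OF v] B.finite_neighbours by force
    then show ?case using v by (intro exI[of _ "{v}"]) auto
  next
    case (Suc m)
    then obtain S L where S: "S \<subseteq> verts T" "card S = Suc m" "partial_cycle k S L" by auto
    then have "S \<subset> verts (remove_loops T)" "S \<noteq> {}" "finite S"
      using Suc.prems vB B.finite_verts by (auto intro: finite_subset)
    then obtain e where e: "e \<in> arcs (remove_loops T)" "tail (remove_loops T) e \<in> S"
      "head (remove_loops T) e \<in> verts T - S"
      using ex_arc_leaving[OF B.wf_digraph_axioms base(2)] vB by metis
    define v where "v = head (remove_loops T) e"
    have "v \<in> neighbours (remove_loops T) (tail (remove_loops T) e)"
      using e by (auto simp: neighbours_def v_def)
    then obtain L' where "partial_cycle k (insert v S) L'"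
      using partial_cycle_insert[OF S(3) \<open>finite S\<close> \<open>2 \<le> k\<close> B.finite_neighbours e(2), of v]
        deg'[of v] e(3) by (auto simp: v_def)
    then show ?case
      using S e(3) \<open>finite S\<close> by (intro exI[of _ "insert v S"]) (auto simp: v_def)
  qed
  moreover have fin: "finite (verts T)" using B.finite_verts vB by simp
  then have "Suc (card (verts T) - 1) = card (verts T)"
    using base(2) vB by (simp add: strongly_connected_def card_gt_0_iff)
  ultimately obtain S L where S: "S \<subseteq> verts T" "card S = card (verts T)" "partial_cycle k S L"
    by (metis order_refl)
  then show ?thesis using card_subset_eq[OF fin] by blast
qed

lemma ex_long_ucycle:
  assumes "fin_digraph (remove_loops T)" "strongly_connected (remove_loops T)" and "2 \<le> k"
    and "\<And>v. v \<in> verts T \<Longrightarrow> nonloop_degree T v * k \<le> n - n div k"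
  shows "\<exists>p. ucycle (with_proj (lift_graph n T \<sigma>)) p \<and>
    card (verts T) * (n - n div k) + k
      \<le> card (cycle_verts (with_proj (lift_graph n T \<sigma>)) p) + card (verts T) * k"
proof -
  obtain L where L: "partial_cycle k (verts T) L" using ex_partial_cycle[OF assms] by blast
  have "closed_path (\<lambda>x y. (x, y) \<in> parcs (lift_graph n T \<sigma>)) (concat L)"
    using L unfolding partial_cycle_def ladj_def by blast
  moreover have "set (concat L) \<subseteq> pverts (lift_graph n T \<sigma>)"
    using L unfolding partial_cycle_def by (simp add: lift_graph_def)
  moreover have "card (set (concat L)) = length (concat L)"
    using L unfolding partial_cycle_def closed_path_def by (blast intro: distinct_card)
  ultimately show ?thesis
    using closed_path_imp_ucycle L unfolding partial_cycle_def by metis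
qed

end

section \<open>Numerical estimates\<close>

theorem theorem7:
  fixes n \<omega> :: nat
    and T :: "('a, 'b) pre_digraph"
    and arev :: "'b \<Rightarrow> 'b"
    and \<sigma> :: "'b \<Rightarrow> int"
  assumes "n > 0" and "\<omega> > 0"
    and "real n * (1 - 1 / real_of_int \<lceil>sqrt (real \<omega>)\<rceil> - real_of_int \<lceil>sqrt (real \<omega>)\<rceil> / real \<omega>)
           \<ge> real_of_int \<lceil>sqrt (real \<omega>)\<rceil>"
    and "reflexive_tree T arev"
    and "\<forall>v \<in> verts T. real (nonloop_degree T v) \<le> real n / real \<omega>"
    and "voltage_assignment n T arev \<sigma>"
    and "\<forall>e \<in> loop_arcs T. coprime (\<sigma> e) (int n)"
  shows "\<exists>p. ucycle (with_proj (lift_graph n T \<sigma>)) p \<and>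
           real (card (cycle_verts (with_proj (lift_graph n T \<sigma>)) p))
             \<ge> (1 - 1 / real_of_int \<lceil>sqrt (real \<omega>)\<rceil> - real_of_int \<lceil>sqrt (real \<omega>)\<rceil> / real \<omega>)
                 * real (card (verts (with_proj (lift_graph n T \<sigma>))))"
proof -
  define k where "k = nat \<lceil>sqrt (real \<omega>)\<rceil>"
  have "0 < sqrt (real \<omega>)" using assms(2) by simp
  then have "0 < \<lceil>sqrt (real \<omega>)\<rceil>" by simp
  then have kc: "real_of_int \<lceil>sqrt (real \<omega>)\<rceil> = real k" and "0 < k" by (auto simp: k_def)
  define \<rho> where "\<rho> = 1 - 1 / real k - real k / real \<omega>"
  have hyp: "real k \<le> real n * \<rho>" using assms(3) by (simp add: kc \<rho>_def)
  have "0 < real n * \<rho>" using hyp \<open>0 < k\<close> by linarith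
  then have "0 < \<rho>" using \<open>n > 0\<close> by (simp add: zero_less_mult_iff)
  \<comment> \<open>Positivity of \<open>\<rho>\<close> forces \<open>k \<ge> 3\<close>: for
    \<open>k = 1\<close> the term \<open>1 / k\<close> is already 1, and for \<open>k = 2\<close>
    the bound \<open>\<omega> \<le> 4\<close> makes both subtracted terms at least 1/2.\<close>
  have "k \<noteq> 1"
    using \<open>0 < \<rho>\<close> by (auto simp: \<rho>_def)
  have "\<omega> \<le> k ^ 2"
  proof -
    have "sqrt (real \<omega>) \<le> real k" using kc le_of_int_ceiling[of "sqrt (real \<omega>)"] by simp
    then have "real \<omega> \<le> real k ^ 2" using sqrt_le_D by blast
    then show ?thesis by (metis of_nat_le_iff of_nat_power)
  qed
  have "k \<noteq> 2"
  proof
    assume "k = 2"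
    then have "real \<omega> \<le> 4" using \<open>\<omega> \<le> k ^ 2\<close> by simp
    then have "real k / real \<omega> \<ge> 1 / 2" using \<open>k = 2\<close> \<open>\<omega> > 0\<close> by (simp add: field_simps)
    then show False using \<open>0 < \<rho>\<close> \<open>k = 2\<close> by (simp add: \<rho>_def)
  qed
  then have "3 \<le> k" using \<open>0 < k\<close> \<open>k \<noteq> 1\<close> by linarith
  \<comment> \<open>From \<open>\<rho> \<le> 1\<close> follows \<open>k \<le> n\<close>, which
    yields the \<open>n \<ge> 3\<close> of the locale.\<close>
  have "0 \<le> 1 / real k" "0 \<le> real k / real \<omega>" by simp_all
  then have "real n * \<rho> \<le> real n * 1"
    unfolding \<rho>_def by (intro mult_left_mono) linarith+
  then have "k \<le> n" using hyp by simp
  have rt: "bidirected_digraph T arev" "utree (remove_loops T)"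
    "\<And>v. v \<in> verts T \<Longrightarrow> card {e \<in> loop_arcs T. tail T e = v} = 2"
    using assms(4) by (auto simp: reflexive_tree_def)
  interpret coprime_lift n T arev \<sigma>
  proof (intro coprime_lift.intro)
    show "\<exists>e\<in>loop_arcs T. tail T e = v" if "v \<in> verts T" for v
      using rt(3)[OF that] by (metis (mono_tags, lifting) card.empty empty_Collect_eq zero_neq_numeral)
  qed (use rt assms \<open>3 \<le> k\<close> \<open>k \<le> n\<close> in auto)
  interpret B: graph "remove_loops T" using rt(2) by (simp add: utree_def)
  have sc: "strongly_connected (remove_loops T)"
    using rt(2) B.symmetric_connected_imp_strongly_connected B.sym_arcs by (simp add: utree_def)
  have divk: "real (n div k) \<le> real n / real k" by (rule of_nat_div_le_of_nat)
  have kn: "real n - real n / real k \<le> real (n - n div k)" using divk by (simp add: of_nat_diff)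
  \<comment> \<open>In this form, \<open>n * \<rho> \<ge> 0\<close> says that
    \<open>n / \<omega>\<close> blocks of size \<open>k\<close> fit into \<open>n - n / k\<close>
    vertices, which gives the degree condition.\<close>
  have nrho: "real n * \<rho> = real n - real n / real k - real n / real \<omega> * real k"
    by (simp add: \<rho>_def algebra_simps)
  have deg: "nonloop_degree T v * k \<le> n - n div k" if "v \<in> verts T" for v
  proof -
    have "real (nonloop_degree T v) * real k \<le> real n / real \<omega> * real k"
      using assms(5) that by (intro mult_right_mono) auto
    also have "\<dots> \<le> real (n - n div k)" using nrho hyp kn by linarith
    finally show ?thesis by (metis of_nat_le_iff of_nat_mult)
  qed
  obtain p where p: "ucycle (with_proj (lift_graph n T \<sigma>)) p"
    and len: "card (verts T) * (n - n div k) + k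
      \<le> card (cycle_verts (with_proj (lift_graph n T \<sigma>)) p) + card (verts T) * k"
    using ex_long_ucycle[OF B.fin_digraph_axioms sc _ deg] \<open>3 \<le> k\<close> by auto
  define N where "N = card (verts T)"
  define C where "C = card (cycle_verts (with_proj (lift_graph n T \<sigma>)) p)"
  have len': "real N * real (n - n div k) + real k \<le> real C + real N * real k"
    using len unfolding N_def[symmetric] C_def[symmetric]
    by (metis of_nat_le_iff of_nat_add of_nat_mult)
  \<comment> \<open>An absorption may lose \<open>k\<close> vertices, while \<open>\<rho>\<close>
    allows for \<open>k * n / \<omega>\<close>. With two or more vertices, connectivity gives a
    degree of at least 1, so \<open>n / \<omega> \<ge> 1\<close> and the allowance suffices; with at
    most one vertex the extra summand \<open>k\<close> in \<open>len'\<close> cancels the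
    loss.\<close>
  have "real N * (real n * \<rho>) \<le> real C"
  proof (cases "N \<le> 1")
    case True
    have "0 \<le> real n / real \<omega> * real k" by simp
    then have "real N * (real n * \<rho>) \<le> real N * real (n - n div k)"
      using nrho kn by (intro mult_left_mono) linarith+
    moreover have "real N * real k \<le> real k" using True by (simp add: mult_left_le_one_le)
    ultimately show ?thesis using len' by linarith
  next
    case False
    obtain v where v: "v \<in> verts T" using False by (force simp: N_def)
    have "verts T \<noteq> {v}" using False by (auto simp: N_def)
    then have "{v} \<subset> verts (remove_loops T)"
      using v by (auto simp: remove_loops_def)
    then obtain e where e: "e \<in> arcs (remove_loops T)" "tail (remove_loops T) e = v"
      using ex_arc_leaving[OF B.wf_digraph_axioms sc, of "{v}"] by auto
    then have "out_arcs (remove_loops T) v \<noteq> {}" by auto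
    then have "1 \<le> nonloop_degree T v"
      by (simp add: nonloop_degree_def out_degree_def Suc_le_eq card_gt_0_iff B.finite_out_arcs)
    then have "1 \<le> real n / real \<omega>" using assms(5) v by force
    then have "1 * real k \<le> real n / real \<omega> * real k" by (intro mult_right_mono) auto
    then have "real n * \<rho> \<le> real (n - n div k) - real k" using nrho kn by linarith
    then have "real N * (real n * \<rho>) \<le> real N * (real (n - n div k) - real k)"
      by (intro mult_left_mono) auto
    then show ?thesis using len' by (simp add: algebra_simps)
  qed
  moreover have "card (verts (with_proj (lift_graph n T \<sigma>))) = N * n"
    by (simp add: lift_graph_def N_def card_cartesian_product)
  ultimately have "\<rho> * real (card (verts (with_proj (lift_graph n T \<sigma>)))) \<le> real C"
    by (simp add: mult_ac)
  then show ?thesis using p by (auto simp: kc \<rho>_def C_def)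
qed

end
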